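(* Let $X$ be a Banach space and let $\alpha$ be a cross-norm on $X\odot X$ such that $X^*\otimes_{\alpha^*}X^*=(X\otimes_\alpha X)^*$. Let $\{x_k\}_{k\ge1}$ be a bounded sequence in $X$. Then the following assertions are equivalent: (i) the sequence $\{x_k\otimes x_k\}$ is weakly ergodic in $X\otimes_\alpha X$; (ii) the sequence $\{x_k\otimes x_k\}$ is weakly mixing to zero in $X\otimes_\alpha X$; (iii) $\{x_k\}$ is weakly mixing to zero.
   Context: $Z^*$ denotes the dual of a Banach space $Z$. $X\odot X$ is the algebraic tensor product; $X\otimes_\alpha X$ is its completion with respect to the cross-norm $\alpha$ (i.e. $\alpha(x\otimes y)=\|x\|\|y\|$). $\alpha^*$ is the conjugate (dual) norm on $X^*\odot X^*$, $\alpha^*(\varphi)=\sup\{|\varphi(u)|:u\in X\odot X,\ \alpha(u)\le1\}$, where $(f\otimes g)(x\otimes y)=f(x)g(y)$; it is part of the setting that $\alpha^*$ is (finite and) a cross-norm. $X^*\otimes_{\alpha^*}X^*$ is the completion of $X^*\odot X^*$ with respect to $\alpha^*$, identified with the norm closure of $X^*\odot X^*$ in $(X\otimes_\alpha X)^*$. A sequence $\{z_k\}_{k\ge1}$ in a Banach space $Z$ is weakly ergodic if $\lim_{n\to\infty}\frac1n|\sum_{k=1}^n f(z_k)|=0$ for all $f\in Z^*$; it is weakly mixing to zero if $\lim_{n\to\infty}\frac1n\sum_{k=1}^n|f(z_k)|=0$ for all $f\in Z^*$.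
   Formalization: The Banach space X is taken over the real numbers; over the complex numbers (i) does not imply (iii), e.g. X = C and x_k = e^{ik}, where x_k⊗x_k = e^{2ik} is weakly ergodic but x_k is not weakly mixing to zero. *)

theory Defs
  imports "HOL-Analysis.Analysis"
begin

section \<open>The algebraic tensor product of two real vector spaces\<close>

text \<open>
  A tensor \<open>x\<^sub>1 \<otimes> y\<^sub>1 + \<dots> + x\<^sub>n \<otimes> y\<^sub>n\<close> is represented by the linear functional
  \<open>B \<mapsto> B x\<^sub>1 y\<^sub>1 + \<dots> + B x\<^sub>n y\<^sub>n\<close> on the space of all bilinear forms on the two factors.  The
  value \<open>0\<close> outside the bilinear forms only serves to make the representing function unique.
  The universal property is proved below as \<open>tensor_universal\<close>.
\<close>

typedef (overloaded) ('a, 'b) tensor =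
  "{T :: ('a::real_vector \<Rightarrow> 'b::real_vector \<Rightarrow> real) \<Rightarrow> real.
     \<exists>ps. \<forall>B. T B = (if bilinear B then (\<Sum>(x, y)\<leftarrow>ps. B x y) else 0)}"
  morphisms tensor_eval Abs_tensor
  by (rule exI[of _ "\<lambda>B. 0"], simp, rule exI[of _ "[]"], simp)

setup_lifting type_definition_tensor

lemma sum_list_pairs_scale:
  fixes B :: "'a::real_vector \<Rightarrow> 'b::real_vector \<Rightarrow> real"
  assumes "bilinear B"
  shows "(\<Sum>(x, y)\<leftarrow>map (\<lambda>(x, y). (c *\<^sub>R x, y)) ps. B x y) = c *\<^sub>R (\<Sum>(x, y)\<leftarrow>ps. B x y)"
  by (induction ps) (auto simp: algebra_simps bilinear_lmul[OF assms])

instantiation tensor :: (real_vector, real_vector) real_vector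
begin

lift_definition zero_tensor :: "('a, 'b) tensor" is "\<lambda>B. 0"
  by (rule exI[of _ "[]"]) simp

lift_definition plus_tensor :: "('a, 'b) tensor \<Rightarrow> ('a, 'b) tensor \<Rightarrow> ('a, 'b) tensor"
  is "\<lambda>S T B. S B + T B"
proof -
  fix S T :: "('a \<Rightarrow> 'b \<Rightarrow> real) \<Rightarrow> real"
  assume "\<exists>ps. \<forall>B. S B = (if bilinear B then (\<Sum>(x, y)\<leftarrow>ps. B x y) else 0)"
    and "\<exists>ps. \<forall>B. T B = (if bilinear B then (\<Sum>(x, y)\<leftarrow>ps. B x y) else 0)"
  then obtain ps qs
    where "\<forall>B. S B = (if bilinear B then (\<Sum>(x, y)\<leftarrow>ps. B x y) else 0)"
      and "\<forall>B. T B = (if bilinear B then (\<Sum>(x, y)\<leftarrow>qs. B x y) else 0)" by blast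
  then show "\<exists>ps. \<forall>B. S B + T B = (if bilinear B then (\<Sum>(x, y)\<leftarrow>ps. B x y) else 0)"
    by (intro exI[of _ "ps @ qs"]) simp
qed

lift_definition scaleR_tensor :: "real \<Rightarrow> ('a, 'b) tensor \<Rightarrow> ('a, 'b) tensor"
  is "\<lambda>c T B. c * T B"
proof -
  fix c and T :: "('a \<Rightarrow> 'b \<Rightarrow> real) \<Rightarrow> real"
  assume "\<exists>ps. \<forall>B. T B = (if bilinear B then (\<Sum>(x, y)\<leftarrow>ps. B x y) else 0)"
  then obtain ps where "\<forall>B. T B = (if bilinear B then (\<Sum>(x, y)\<leftarrow>ps. B x y) else 0)"
    by blast
  then show "\<exists>ps. \<forall>B. c * T B = (if bilinear B then (\<Sum>(x, y)\<leftarrow>ps. B x y) else 0)"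
    using sum_list_pairs_scale[where c = c and ps = ps]
    by (intro exI[of _ "map (\<lambda>(x, y). (c *\<^sub>R x, y)) ps"]) simp
qed

definition uminus_tensor :: "('a, 'b) tensor \<Rightarrow> ('a, 'b) tensor"
  where "uminus_tensor T = (-1) *\<^sub>R T"

definition minus_tensor :: "('a, 'b) tensor \<Rightarrow> ('a, 'b) tensor \<Rightarrow> ('a, 'b) tensor"
  where "minus_tensor S T = S + (-1) *\<^sub>R (T :: ('a, 'b) tensor)"

instance
  by standard
    (unfold uminus_tensor_def minus_tensor_def,
      (transfer, simp add: fun_eq_iff algebra_simps)+)

end

lift_definition tprod :: "'a::real_vector \<Rightarrow> 'b::real_vector \<Rightarrow> ('a, 'b) tensor"
  (infixl "\<otimes>" 70)
  is "\<lambda>x y B. if bilinear B then B x y else 0"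
proof -
  fix x :: 'a and y :: 'b
  show "\<exists>ps. \<forall>B. (if bilinear B then B x y else 0) =
      (if bilinear B then (\<Sum>(x, y)\<leftarrow>ps. B x y) else 0)"
    by (rule exI[of _ "[(x, y)]"]) simp
qed

lemma tensor_eval_zero [simp]: "tensor_eval 0 B = 0"
  by transfer simp

lemma tensor_eval_add: "tensor_eval (S + T) B = tensor_eval S B + tensor_eval T B"
  by transfer simp

lemma tensor_eval_scaleR: "tensor_eval (c *\<^sub>R T) B = c * tensor_eval T B"
  by transfer simp

lemma tensor_eval_tprod: "bilinear B \<Longrightarrow> tensor_eval (x \<otimes> y) B = B x y"
  by transfer simp

lemma tensor_eval_nonbilinear: "\<not> bilinear B \<Longrightarrow> tensor_eval T B = 0"
  by transfer auto

lemma tensor_eqI: "(\<And>B. bilinear B \<Longrightarrow> tensor_eval S B = tensor_eval T B) \<Longrightarrow> S = T"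
  by (metis ext tensor_eval_inject tensor_eval_nonbilinear)

lemma tensor_eval_sum_list:
  "bilinear B \<Longrightarrow> tensor_eval (\<Sum>(x, y)\<leftarrow>ps. x \<otimes> y) B = (\<Sum>(x, y)\<leftarrow>ps. B x y)"
  by (induction ps) (auto simp: tensor_eval_add tensor_eval_tprod)

lemma tensor_sum_list: "\<exists>ps. T = (\<Sum>(x, y)\<leftarrow>ps. x \<otimes> y)"
proof -
  obtain ps where "\<forall>B. tensor_eval T B = (if bilinear B then (\<Sum>(x, y)\<leftarrow>ps. B x y) else 0)"
    using tensor_eval[of T] by blast
  then have "T = (\<Sum>(x, y)\<leftarrow>ps. x \<otimes> y)"
    by (intro tensor_eqI) (simp add: tensor_eval_sum_list)
  then show ?thesis ..
qed

lemma bilinear_tprod: "bilinear (\<lambda>x y. x \<otimes> y)"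
  unfolding bilinear_def
  by (auto intro!: linearI tensor_eqI
      simp: tensor_eval_add tensor_eval_scaleR tensor_eval_tprod
        bilinear_ladd bilinear_radd bilinear_lmul bilinear_rmul)

lemma linear_functionals_separate:
  fixes v :: "'c::real_vector"
  assumes "\<And>g :: 'c \<Rightarrow> real. linear g \<Longrightarrow> g v = 0"
  shows "v = 0"
proof (rule ccontr)
  assume "v \<noteq> 0"
  then have "independent {v}" by simp
  from linear_independent_extend[OF this, of "\<lambda>_. 1 :: real"] show False
    using assms by fastforce
qed

theorem tensor_universal:
  fixes B :: "'a::real_vector \<Rightarrow> 'b::real_vector \<Rightarrow> 'c::real_vector"
  assumes B: "bilinear B"
  shows "\<exists>!L. linear L \<and> (\<forall>x y. L (x \<otimes> y) = B x y)"
proof -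
  define S where "S ps = (\<Sum>(x, y)\<leftarrow>ps. B x y)" for ps
  define P :: "('a \<times> 'b) list \<Rightarrow> ('a, 'b) tensor"
    where "P ps = (\<Sum>(x, y)\<leftarrow>ps. x \<otimes> y)" for ps
  have bil: "bilinear (\<lambda>x y. g (B x y))" if "linear g" for g :: "'c \<Rightarrow> real"
    using B unfolding bilinear_def
    by (auto intro!: linear_compose[where g = g, OF _ that, unfolded comp_def])
  have gS: "g (S ps) = tensor_eval (P ps) (\<lambda>x y. g (B x y))" if "linear g"
    for g :: "'c \<Rightarrow> real" and ps
  proof -
    have "g (S ps) = (\<Sum>(x, y)\<leftarrow>ps. g (B x y))"
      unfolding S_def by (induction ps) (auto simp: linear_0[OF that] linear_add[OF that])
    then show ?thesis by (simp add: P_def tensor_eval_sum_list[OF bil[OF that]])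
  qed
  define L where "L T = S (SOME ps. T = P ps)" for T
  have ex: "T = P (SOME ps. T = P ps)" for T
    using tensor_sum_list[of T] unfolding P_def by (rule someI_ex)
  have gL: "g (L T) = tensor_eval T (\<lambda>x y. g (B x y))" if "linear g" for g :: "'c \<Rightarrow> real" and T
    unfolding L_def gS[OF that] ex[of T, symmetric] ..
  have eqI: "v = w" if eq: "\<And>g :: 'c \<Rightarrow> real. linear g \<Longrightarrow> g v = g w" for v w :: 'c
  proof -
    have "g (v - w) = 0" if g: "linear g" for g :: "'c \<Rightarrow> real"
      unfolding linear_diff[OF g] eq[OF g] by simp
    then have "v - w = 0" by (rule linear_functionals_separate)
    then show "v = w" by simp
  qed
  have "linear L"
    by (rule linearI; rule eqI)
      (simp_all add: gL linear_add linear_scale tensor_eval_add tensor_eval_scaleR)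
  moreover have "L (x \<otimes> y) = B x y" for x y
  proof (rule eqI)
    fix g :: "'c \<Rightarrow> real" assume g: "linear g"
    show "g (L (x \<otimes> y)) = g (B x y)" by (simp add: gL[OF g] tensor_eval_tprod[OF bil[OF g]])
  qed
  moreover have "L' = L''"
    if "linear L' \<and> (\<forall>x y. L' (x \<otimes> y) = B x y)" "linear L'' \<and> (\<forall>x y. L'' (x \<otimes> y) = B x y)"
    for L' L''
  proof
    fix T :: "('a, 'b) tensor"
    have "L' (P ps) = L'' (P ps)" for ps
      unfolding P_def using that by (induction ps) (auto simp: linear_0 linear_add)
    from this[of "SOME ps. T = P ps"] show "L' T = L'' T"
      unfolding ex[of T, symmetric] .
  qed
  ultimately show ?thesis by (intro ex1I[of _ L]) auto
qed


section \<open>Cross-norms and their conjugates\<close>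

definition vs_norm :: "('v::real_vector \<Rightarrow> real) \<Rightarrow> bool" where
  "vs_norm \<alpha> \<longleftrightarrow>
     (\<forall>u. 0 \<le> \<alpha> u) \<and>
     (\<forall>u. \<alpha> u = 0 \<longleftrightarrow> u = 0) \<and>
     (\<forall>u v. \<alpha> (u + v) \<le> \<alpha> u + \<alpha> v) \<and>
     (\<forall>c u. \<alpha> (c *\<^sub>R u) = \<bar>c\<bar> * \<alpha> u)"

definition cross_norm ::
    "(('a::real_normed_vector, 'b::real_normed_vector) tensor \<Rightarrow> real) \<Rightarrow> bool" where
  "cross_norm \<alpha> \<longleftrightarrow> vs_norm \<alpha> \<and> (\<forall>x y. \<alpha> (x \<otimes> y) = norm x * norm y)"

text \<open>
  The inner evaluation is \<open>(f \<otimes> g)(u)\<close>, the value at \<open>u\<close> of the linearisation of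
  \<open>(x, y) \<mapsto> f x * g y\<close>; the outer one extends it linearly from \<open>f \<otimes> g\<close> to all tensors over the
  duals.
\<close>

definition tensor_pairing ::
    "('a::real_normed_vector \<Rightarrow>\<^sub>L real, 'b::real_normed_vector \<Rightarrow>\<^sub>L real) tensor \<Rightarrow>
     ('a, 'b) tensor \<Rightarrow> real" where
  "tensor_pairing \<phi> u =
     tensor_eval \<phi> (\<lambda>f g. tensor_eval u (\<lambda>x y. blinfun_apply f x * blinfun_apply g y))"

lemma bilinear_dual_product:
  "bilinear (\<lambda>x y. blinfun_apply f x * blinfun_apply g y :: real)"
  unfolding bilinear_def
  by (auto intro!: linearI simp: blinfun.add_right blinfun.scaleR_right algebra_simps)

lemma bilinear_tensor_eval_dual:
  "bilinear (\<lambda>f g. tensor_eval u (\<lambda>x y. blinfun_apply f x * blinfun_apply g y :: real))"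
proof -
  obtain ps where u: "u = (\<Sum>(x, y)\<leftarrow>ps. x \<otimes> y)" using tensor_sum_list by blast
  show ?thesis
    unfolding u tensor_eval_sum_list[OF bilinear_dual_product] bilinear_def
    by (intro conjI allI linearI; induction ps)
      (auto simp: blinfun.add_left blinfun.scaleR_left algebra_simps)
qed

lemma tensor_pairing_tprod:
  "tensor_pairing (f \<otimes> g) (x \<otimes> y) = blinfun_apply f x * blinfun_apply g y"
  unfolding tensor_pairing_def tensor_eval_tprod[OF bilinear_tensor_eval_dual]
  by (rule tensor_eval_tprod[OF bilinear_dual_product])

lemma linear_tensor_pairing_left: "linear (\<lambda>\<phi>. tensor_pairing \<phi> u)"
  by (rule linearI) (simp_all add: tensor_pairing_def tensor_eval_add tensor_eval_scaleR)

lemma linear_tensor_pairing_right: "linear (tensor_pairing \<phi>)"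
proof -
  obtain ps where \<phi>: "\<phi> = (\<Sum>(f, g)\<leftarrow>ps. f \<otimes> g)" using tensor_sum_list by blast
  show ?thesis
    unfolding \<phi> tensor_pairing_def tensor_eval_sum_list[OF bilinear_tensor_eval_dual]
    by (rule linearI; induction ps)
      (auto simp: tensor_eval_add tensor_eval_scaleR algebra_simps)
qed

definition conj_norm ::
    "(('a::real_normed_vector, 'b::real_normed_vector) tensor \<Rightarrow> real) \<Rightarrow>
     ('a \<Rightarrow>\<^sub>L real, 'b \<Rightarrow>\<^sub>L real) tensor \<Rightarrow> real" where
  "conj_norm \<alpha> \<phi> = (SUP u\<in>{u. \<alpha> u \<le> 1}. \<bar>tensor_pairing \<phi> u\<bar>)"

text \<open>
  A real-valued \<open>SUP\<close> is unspecified on unbounded sets, so finiteness is a separate condition.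
\<close>

definition conj_norm_finite ::
    "(('a::real_normed_vector, 'b::real_normed_vector) tensor \<Rightarrow> real) \<Rightarrow> bool" where
  "conj_norm_finite \<alpha> \<longleftrightarrow>
     (\<forall>\<phi>. bdd_above ((\<lambda>u. \<bar>tensor_pairing \<phi> u\<bar>) ` {u. \<alpha> u \<le> 1}))"


section \<open>Completions\<close>

text \<open>
  A completion depends on the norm \<open>\<alpha>\<close> and hence cannot be a type constructed from the factors;
  it is therefore given as a Banach space \<open>'z\<close> with a linear, isometric, dense embedding \<open>\<iota>\<close>,
  which determines it up to isometric isomorphism.
\<close>

definition is_completion :: "('v::real_vector \<Rightarrow> real) \<Rightarrow> ('v \<Rightarrow> 'z::banach) \<Rightarrow> bool" where
  "is_completion \<alpha> \<iota> \<longleftrightarrow>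
     linear \<iota> \<and> (\<forall>u. norm (\<iota> u) = \<alpha> u) \<and> closure (range \<iota>) = UNIV"

text \<open>
  The completion of the tensor product of the duals in the conjugate norm, as the closure in the
  dual of \<open>'z\<close>: \<open>\<phi>\<close> corresponds to the unique bounded functional on \<open>'z\<close> that extends
  \<open>tensor_pairing \<phi>\<close> along \<open>\<iota>\<close>.
\<close>

definition dual_tensor_completion ::
    "(('a::real_normed_vector, 'b::real_normed_vector) tensor \<Rightarrow> 'z::banach) \<Rightarrow>
     ('z \<Rightarrow>\<^sub>L real) set" where
  "dual_tensor_completion \<iota> =
     closure {F. \<exists>\<phi>. \<forall>u. blinfun_apply F (\<iota> u) = tensor_pairing \<phi> u}"


section \<open>Ergodic properties of sequences\<close>

text \<open>Sequences are indexed from 1; the value at index 0 is irrelevant.\<close>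

definition weakly_ergodic :: "(nat \<Rightarrow> 'z::real_normed_vector) \<Rightarrow> bool" where
  "weakly_ergodic z \<longleftrightarrow>
     (\<forall>f :: 'z \<Rightarrow>\<^sub>L real.
        (\<lambda>n. 1 / real n * \<bar>\<Sum>k=1..n. blinfun_apply f (z k)\<bar>) \<longlonglongrightarrow> 0)"

definition weakly_mixing_to_zero :: "(nat \<Rightarrow> 'z::real_normed_vector) \<Rightarrow> bool" where
  "weakly_mixing_to_zero z \<longleftrightarrow>
     (\<forall>f :: 'z \<Rightarrow>\<^sub>L real.
        (\<lambda>n. 1 / real n * (\<Sum>k=1..n. \<bar>blinfun_apply f (z k)\<bar>)) \<longlonglongrightarrow> 0)"

end

theory Submission
  imports Defs
begin

text \<open>
  An elementary functional \<open>f \<otimes> f\<close> sends \<open>x \<otimes> x\<close> to the nonnegative number \<open>(f x)\<^sup>2\<close>, so weak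
  ergodicity of \<open>x\<^sub>k \<otimes> x\<^sub>k\<close> makes the averages of \<open>(f x\<^sub>k)\<^sup>2\<close> vanish, and
  \<open>\<bar>t\<bar> \<le> t\<^sup>2 / \<epsilon> + \<epsilon>\<close> then gives mixing of \<open>x\<^sub>k\<close>.  Conversely every functional on the completion is
  a norm limit of finite sums of functionals \<open>f \<otimes> g\<close>, and \<open>\<bar>f x\<^sub>k * g x\<^sub>k\<bar> \<le> C \<bar>f x\<^sub>k\<bar>\<close> by
  boundedness of the sequence.
\<close>

section \<open>Strong Cesaro convergence to zero of scalar sequences\<close>

definition strong_cesaro_null :: "(nat \<Rightarrow> real) \<Rightarrow> bool" where
  "strong_cesaro_null a \<longleftrightarrow> (\<lambda>n. 1 / real n * (\<Sum>k=1..n. \<bar>a k\<bar>)) \<longlonglongrightarrow> 0"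

lemma weakly_mixing_iff_strong_cesaro_null:
  "weakly_mixing_to_zero z \<longleftrightarrow>
     (\<forall>f :: 'a::real_normed_vector \<Rightarrow>\<^sub>L real. strong_cesaro_null (\<lambda>k. blinfun_apply f (z k)))"
  by (simp add: weakly_mixing_to_zero_def strong_cesaro_null_def)

lemma strong_cesaro_null_mono:
  assumes b: "strong_cesaro_null b" and le: "\<And>k. k \<ge> 1 \<Longrightarrow> \<bar>a k\<bar> \<le> \<bar>b k\<bar>"
  shows "strong_cesaro_null a"
  unfolding strong_cesaro_null_def
proof (rule tendsto_sandwich[OF _ _ tendsto_const b[unfolded strong_cesaro_null_def]])
  show "\<forall>\<^sub>F n in sequentially. 0 \<le> 1 / real n * (\<Sum>k=1..n. \<bar>a k\<bar>)"
    by (simp add: sum_nonneg)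
  show "\<forall>\<^sub>F n in sequentially. 1 / real n * (\<Sum>k=1..n. \<bar>a k\<bar>) \<le> 1 / real n * (\<Sum>k=1..n. \<bar>b k\<bar>)"
    by (intro always_eventually allI mult_left_mono sum_mono le) auto
qed

lemma strong_cesaro_null_add:
  assumes "strong_cesaro_null a" "strong_cesaro_null b"
  shows "strong_cesaro_null (\<lambda>k. a k + b k)"
proof -
  have "strong_cesaro_null (\<lambda>k. \<bar>a k\<bar> + \<bar>b k\<bar>)"
    using tendsto_add[OF assms[unfolded strong_cesaro_null_def]]
    by (simp add: strong_cesaro_null_def sum.distrib distrib_left)
  then show ?thesis
    by (rule strong_cesaro_null_mono) linarith
qed

lemma strong_cesaro_null_cmult:
  assumes "strong_cesaro_null a"
  shows "strong_cesaro_null (\<lambda>k. c * a k)"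
  using tendsto_mult_left[OF assms[unfolded strong_cesaro_null_def], of "\<bar>c\<bar>"]
  by (simp add: strong_cesaro_null_def abs_mult sum_distrib_left mult.left_commute)

text \<open>A constant error \<open>e\<close> adds at most \<open>e\<close> to every mean, so the
  upper limit of the means of \<bar>a k\<bar> is at most \<open>e\<close>, for every positive
  \<open>e\<close>. This limiting argument serves twice: for removing a square and for passing to
  norm limits of functionals.\<close>

lemma strong_cesaro_null_approx:
  assumes approx: "\<And>e. e > 0 \<Longrightarrow> \<exists>b. strong_cesaro_null b \<and> (\<forall>k\<ge>1. \<bar>a k\<bar> \<le> \<bar>b k\<bar> + e)"
  shows "strong_cesaro_null a"
  unfolding strong_cesaro_null_def
proof (rule LIMSEQ_I)
  fix e :: real assume "e > 0"
  then obtain b where b: "strong_cesaro_null b" and le: "\<And>k. k \<ge> 1 \<Longrightarrow> \<bar>a k\<bar> \<le> \<bar>b k\<bar> + e / 2"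
    using approx[of "e / 2"] by auto
  obtain N where N: "\<And>n. n \<ge> N \<Longrightarrow> \<bar>1 / real n * (\<Sum>k=1..n. \<bar>b k\<bar>)\<bar> < e / 2"
    using LIMSEQ_D[OF b[unfolded strong_cesaro_null_def], of "e / 2"] \<open>e > 0\<close> by auto
  have "norm (1 / real n * (\<Sum>k=1..n. \<bar>a k\<bar>) - 0) < e" if "n \<ge> N" for n
  \<comment> \<open>For \<open>n = 0\<close> the factor \<open>1 / real n\<close> is 0 by
    convention, and the mean of the constant \<open>e / 2\<close> is \<open>e / 2\<close> only for
    positive \<open>n\<close>.\<close>
  proof (cases "n = 0")
    case False
    have "(\<Sum>k=1..n. \<bar>a k\<bar>) \<le> (\<Sum>k=1..n. \<bar>b k\<bar> + e / 2)"
      by (intro sum_mono le) simp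
    also have "\<dots> = (\<Sum>k=1..n. \<bar>b k\<bar>) + real n * (e / 2)"
      by (simp add: sum.distrib)
    finally have "1 / real n * (\<Sum>k=1..n. \<bar>a k\<bar>) \<le> 1 / real n * (\<Sum>k=1..n. \<bar>b k\<bar>) + e / 2"
      using False by (simp add: field_simps)
    moreover have "0 \<le> 1 / real n * (\<Sum>k=1..n. \<bar>a k\<bar>)"
      by (simp add: sum_nonneg)
    ultimately show ?thesis
      using N[OF that] unfolding real_norm_def by linarith
  qed (simp add: \<open>e > 0\<close>)
  then show "\<exists>N. \<forall>n\<ge>N. norm (1 / real n * (\<Sum>k=1..n. \<bar>a k\<bar>) - 0) < e"
    by blast
qed

text \<open>A pointwise inequality takes the place of Cauchy-Schwarz: for fixed \<open>e\<close> the
  multiple \<open>1 / e\<close> of the squares is still null in the mean.\<close>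

lemma strong_cesaro_null_of_square:
  assumes sq: "strong_cesaro_null (\<lambda>k. (a k)\<^sup>2)"
  shows "strong_cesaro_null a"
proof (rule strong_cesaro_null_approx)
  fix e :: real assume "e > 0"
  have "\<bar>t\<bar> \<le> \<bar>1 / e * t\<^sup>2\<bar> + e" for t
  proof -
    have "2 * \<bar>t\<bar> * e \<le> t\<^sup>2 + e\<^sup>2"
      using sum_squares_bound[of "\<bar>t\<bar>" e] by simp
    moreover have "0 \<le> \<bar>t\<bar> * e" using \<open>e > 0\<close> by simp
    ultimately have "\<bar>t\<bar> * e \<le> t\<^sup>2 + e\<^sup>2" by linarith
    then show ?thesis
      using \<open>e > 0\<close> by (simp add: field_simps power2_eq_square)
  qed
  then show "\<exists>b. strong_cesaro_null b \<and> (\<forall>k\<ge>1. \<bar>a k\<bar> \<le> \<bar>b k\<bar> + e)"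
    using strong_cesaro_null_cmult[OF sq, of "1 / e"] by blast
qed

section \<open>Functionals on the completion\<close>

text \<open>This is extension by continuity from a dense subspace: \<open>L\<close> factors through
  \<iota>, is Lipschitz on the range, and the target is complete. It will turn tensors over the dual
  into bounded functionals on the completion.\<close>

lemma is_completion_extend:
  fixes \<iota> :: "'v::real_vector \<Rightarrow> 'z::banach" and L :: "'v \<Rightarrow> 'w::banach"
  assumes \<iota>: "is_completion \<alpha> \<iota>" and L: "linear L"
    and bound: "\<And>u. norm (L u) \<le> C * \<alpha> u"
  shows "\<exists>F. \<forall>u. blinfun_apply F (\<iota> u) = L u"
proof -
  have lin: "linear \<iota>" and norm_\<iota>: "norm (\<iota> u) = \<alpha> u" and dense: "closure (range \<iota>) = UNIV" for u
    using \<iota> by (auto simp: is_completion_def)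
  \<comment> \<open>Equal images force \<alpha> (u - v) = 0, so the bound kills
    \<open>L (u - v)\<close>. Hence \<open>g\<close> below does not depend on the preimage picked by
    \<open>inv\<close>.\<close>
  have eq: "L u = L v" if "\<iota> u = \<iota> v" for u v
    using bound[of "u - v"] norm_\<iota>[of "u - v"] that
    by (simp add: linear_diff[OF lin] linear_diff[OF L])
  define g where "g y = L (inv \<iota> y)" for y
  have g: "g (\<iota> u) = L u" for u
    unfolding g_def by (rule eq) (simp add: f_inv_into_f)
  \<comment> \<open>A Lipschitz constant must be nonnegative, and \<open>C\<close> carries no sign
    condition; hence the absolute value.\<close>
  have "(\<bar>C\<bar>)-lipschitz_on (range \<iota>) g"
  proof (rule lipschitz_onI)
    fix y z assume "y \<in> range \<iota>" "z \<in> range \<iota>"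
    then obtain u v where uv: "y = \<iota> u" "z = \<iota> v" by blast
    have "dist (g y) (g z) = norm (L (u - v))"
      by (simp add: uv g dist_norm linear_diff[OF L])
    also have "\<dots> \<le> C * norm (\<iota> (u - v))"
      unfolding norm_\<iota> by (rule bound)
    also have "\<dots> \<le> \<bar>C\<bar> * dist y z"
      by (simp add: uv dist_norm linear_diff[OF lin] mult_right_mono)
    finally show "dist (g y) (g z) \<le> \<bar>C\<bar> * dist y z" .
  qed simp
  then obtain h where h: "(\<bar>C\<bar>)-lipschitz_on UNIV h" and hg: "\<And>y. y \<in> range \<iota> \<Longrightarrow> h y = g y"
    using lipschitz_extend_closure[of "\<bar>C\<bar>" "range \<iota>" g] dense by auto
  have h\<iota>: "h (\<iota> u) = L u" for u
    by (simp add: hg g)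
  have cont: "isCont h y" for y
    using lipschitz_on_continuous_on[OF h] by (simp add: continuous_on_eq_continuous_at)
  have approx: "\<exists>u. (\<lambda>n. \<iota> (u n)) \<longlonglongrightarrow> y" for y
  proof -
    have "y \<in> closure (range \<iota>)" using dense by simp
    then obtain s where s: "\<And>n. s n \<in> range \<iota>" "s \<longlonglongrightarrow> y"
      unfolding closure_sequential by blast
    have "(\<lambda>n. \<iota> (inv \<iota> (s n))) = s"
      by (rule ext) (rule f_inv_into_f[OF s(1)])
    then show ?thesis using s(2) by (intro exI[of _ "\<lambda>n. inv \<iota> (s n)"]) simp
  qed
  \<comment> \<open>Additivity and homogeneity hold on the range of \<iota>, where \<open>h\<close>
    agrees with \<open>L\<close>, and pass to limits by continuity.\<close>
  have "bounded_linear h"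
  proof (rule bounded_linear_intro)
    fix y z
    obtain u v where u: "(\<lambda>n. \<iota> (u n)) \<longlonglongrightarrow> y" and v: "(\<lambda>n. \<iota> (v n)) \<longlonglongrightarrow> z"
      using approx by metis
    have "(\<lambda>n. h (\<iota> (u n) + \<iota> (v n))) \<longlonglongrightarrow> h (y + z)"
      by (intro isCont_tendsto_compose[OF cont] tendsto_add u v)
    moreover have "h (\<iota> (u n) + \<iota> (v n)) = h (\<iota> (u n)) + h (\<iota> (v n))" for n
      by (simp add: h\<iota> linear_add[OF L] flip: linear_add[OF lin])
    moreover have "(\<lambda>n. h (\<iota> (u n)) + h (\<iota> (v n))) \<longlonglongrightarrow> h y + h z"
      by (intro tendsto_add isCont_tendsto_compose[OF cont] u v)
    ultimately show "h (y + z) = h y + h z"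
      by (simp add: LIMSEQ_unique)
  next
    fix r y
    obtain u where u: "(\<lambda>n. \<iota> (u n)) \<longlonglongrightarrow> y"
      using approx by metis
    have "(\<lambda>n. h (r *\<^sub>R \<iota> (u n))) \<longlonglongrightarrow> h (r *\<^sub>R y)"
      by (intro isCont_tendsto_compose[OF cont] tendsto_scaleR tendsto_const u)
    moreover have "h (r *\<^sub>R \<iota> (u n)) = r *\<^sub>R h (\<iota> (u n))" for n
      by (simp add: h\<iota> linear_scale[OF L] flip: linear_scale[OF lin])
    moreover have "(\<lambda>n. r *\<^sub>R h (\<iota> (u n))) \<longlonglongrightarrow> r *\<^sub>R h y"
      by (intro tendsto_scaleR tendsto_const isCont_tendsto_compose[OF cont] u)
    ultimately show "h (r *\<^sub>R y) = r *\<^sub>R h y"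
      by (simp add: LIMSEQ_unique)
  next
    fix y
    have "h 0 = 0"
      using h\<iota>[of 0] by (simp add: linear_0[OF lin] linear_0[OF L])
    then show "norm (h y) \<le> norm y * \<bar>C\<bar>"
      using lipschitz_onD[OF h, of y 0] by (simp add: dist_norm mult.commute)
  qed
  then show ?thesis
    by (intro exI[of _ "Blinfun h"]) (simp add: bounded_linear_Blinfun_apply h\<iota>)
qed

text \<open>A nonzero \<open>u\<close> is scaled to the unit sphere of \<alpha>, where finiteness
  makes the supremum a genuine upper bound. The inequality supplies the constant \<open>C\<close>
  for \<open>is_completion_extend\<close>.\<close>

lemma abs_tensor_pairing_le_conj_norm:
  assumes norm: "vs_norm \<alpha>" and fin: "conj_norm_finite \<alpha>"
  shows "\<bar>tensor_pairing \<phi> u\<bar> \<le> conj_norm \<alpha> \<phi> * \<alpha> u"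
proof (cases "u = 0")
  case True
  moreover have "\<alpha> 0 = 0"
    using norm unfolding vs_norm_def by blast
  ultimately show ?thesis
    by (simp add: linear_0[OF linear_tensor_pairing_right])
next
  case False
  then have pos: "\<alpha> u > 0"
    using norm unfolding vs_norm_def by (metis order_le_less)
  have "\<alpha> ((1 / \<alpha> u) *\<^sub>R u) = \<bar>1 / \<alpha> u\<bar> * \<alpha> u"
    using norm unfolding vs_norm_def by blast
  then have "\<alpha> ((1 / \<alpha> u) *\<^sub>R u) \<le> 1"
    using pos by simp
  then have "\<bar>tensor_pairing \<phi> ((1 / \<alpha> u) *\<^sub>R u)\<bar> \<le> conj_norm \<alpha> \<phi>"
    unfolding conj_norm_def
    using fin by (intro cSUP_upper) (auto simp: conj_norm_finite_def)
  moreover have "\<bar>tensor_pairing \<phi> ((1 / \<alpha> u) *\<^sub>R u)\<bar> = \<bar>tensor_pairing \<phi> u\<bar> / \<alpha> u"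
    using pos by (simp add: linear_scale[OF linear_tensor_pairing_right] abs_mult)
  ultimately show ?thesis
    using pos by (simp add: field_simps)
qed

section \<open>The implications between the three properties\<close>

lemma weakly_mixing_imp_weakly_ergodic:
  assumes "weakly_mixing_to_zero z"
  shows "weakly_ergodic z"
  unfolding weakly_ergodic_def
proof
  fix f
  show "(\<lambda>n. 1 / real n * \<bar>\<Sum>k=1..n. blinfun_apply f (z k)\<bar>) \<longlonglongrightarrow> 0"
  proof (rule tendsto_sandwich[OF _ _ tendsto_const])
    show "(\<lambda>n. 1 / real n * (\<Sum>k=1..n. \<bar>blinfun_apply f (z k)\<bar>)) \<longlonglongrightarrow> 0"
      using assms by (simp add: weakly_mixing_to_zero_def)
    show "\<forall>\<^sub>F n in sequentially. 1 / real n * \<bar>\<Sum>k=1..n. blinfun_apply f (z k)\<bar>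
        \<le> 1 / real n * (\<Sum>k=1..n. \<bar>blinfun_apply f (z k)\<bar>)"
      by (intro always_eventually allI mult_left_mono sum_abs) simp
  qed simp
qed

text \<open>From (i) to (iii): each \<open>f\<close> is tested through the bounded extension of
  \<open>f \<otimes> f\<close> to the completion.\<close>

lemma weakly_mixing_of_weakly_ergodic_squares:
  fixes x :: "nat \<Rightarrow> 'a::real_normed_vector" and \<iota> :: "('a, 'a) tensor \<Rightarrow> 'z::banach"
  assumes norm: "vs_norm \<alpha>" and fin: "conj_norm_finite \<alpha>" and \<iota>: "is_completion \<alpha> \<iota>"
    and erg: "weakly_ergodic (\<lambda>k. \<iota> (x k \<otimes> x k))"
  shows "weakly_mixing_to_zero x"
  unfolding weakly_mixing_iff_strong_cesaro_null
proof
  fix f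
  have "\<exists>F. \<forall>u. blinfun_apply F (\<iota> u) = tensor_pairing (f \<otimes> f) u"
    using abs_tensor_pairing_le_conj_norm[OF norm fin]
    by (intro is_completion_extend[OF \<iota> linear_tensor_pairing_right]) simp
  then obtain F where "\<And>u. blinfun_apply F (\<iota> u) = tensor_pairing (f \<otimes> f) u"
    by blast
  then have F: "blinfun_apply F (\<iota> (x k \<otimes> x k)) = (blinfun_apply f (x k))\<^sup>2" for k
    by (simp add: tensor_pairing_tprod power2_eq_square)
  have "(\<lambda>n. 1 / real n * \<bar>\<Sum>k=1..n. (blinfun_apply f (x k))\<^sup>2\<bar>) \<longlonglongrightarrow> 0"
    using erg unfolding weakly_ergodic_def F[symmetric] by blast
  \<comment> \<open>Squares cannot cancel, so the absolute value may move inside the sum; this turns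
    ergodicity into mixing.\<close>
  then have "strong_cesaro_null (\<lambda>k. (blinfun_apply f (x k))\<^sup>2)"
    by (simp add: strong_cesaro_null_def sum_nonneg)
  then show "strong_cesaro_null (\<lambda>k. blinfun_apply f (x k))"
    by (rule strong_cesaro_null_of_square)
qed

text \<open>Smallness in the mean comes from the first factor alone while the second stays bounded;
  finite sums then cover every tensor.\<close>

lemma strong_cesaro_null_tensor_pairing:
  assumes mix: "weakly_mixing_to_zero x" and bdd: "\<And>k. k \<ge> 1 \<Longrightarrow> norm (y k) \<le> M"
  shows "strong_cesaro_null (\<lambda>k. tensor_pairing \<phi> (x k \<otimes> y k))"
proof -
  have elementary: "strong_cesaro_null (\<lambda>k. tensor_pairing (f \<otimes> g) (x k \<otimes> y k))" for f g
  proof (rule strong_cesaro_null_mono)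
    show "strong_cesaro_null (\<lambda>k. norm g * M * blinfun_apply f (x k))"
      using mix unfolding weakly_mixing_iff_strong_cesaro_null
      by (intro strong_cesaro_null_cmult) blast
    fix k :: nat assume "k \<ge> 1"
    have "\<bar>blinfun_apply g (y k)\<bar> \<le> norm g * norm (y k)"
      using norm_blinfun[of g "y k"] by simp
    also have "\<dots> \<le> norm g * M"
      by (intro mult_left_mono bdd \<open>k \<ge> 1\<close>) simp
    also have "\<dots> \<le> \<bar>norm g * M\<bar>" by simp
    finally show "\<bar>tensor_pairing (f \<otimes> g) (x k \<otimes> y k)\<bar> \<le> \<bar>norm g * M * blinfun_apply f (x k)\<bar>"
      unfolding tensor_pairing_tprod abs_mult[of _ "blinfun_apply f (x k)"]
      by (simp add: abs_mult mult.commute mult_left_mono)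
  qed
  obtain ps where \<phi>: "\<phi> = (\<Sum>(f, g)\<leftarrow>ps. f \<otimes> g)"
    using tensor_sum_list by blast
  show ?thesis
    unfolding \<phi>
  proof (induction ps)
    case Nil
    show ?case
      by (simp add: strong_cesaro_null_def linear_0[OF linear_tensor_pairing_left])
  next
    case (Cons p ps)
    obtain f g where "p = (f, g)" by (cases p)
    then show ?case
      using strong_cesaro_null_add[OF elementary[of f g] Cons.IH]
      by (simp add: linear_add[OF linear_tensor_pairing_left])
  qed
qed

text \<open>From (iii) to (ii): by the duality hypothesis the functionals given by tensors are norm
  dense, and the approximation is uniform in \<open>k\<close> because the elementary tensors stay
  bounded.\<close>

lemma weakly_mixing_squares_of_weakly_mixing:
  fixes x :: "nat \<Rightarrow> 'a::real_normed_vector" and \<iota> :: "('a, 'a) tensor \<Rightarrow> 'z::banach"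
  assumes cross: "cross_norm \<alpha>" and \<iota>: "is_completion \<alpha> \<iota>"
    and dual: "dual_tensor_completion \<iota> = UNIV" and bdd: "bounded (x ` {1..})"
    and mix: "weakly_mixing_to_zero x"
  shows "weakly_mixing_to_zero (\<lambda>k. \<iota> (x k \<otimes> x k))"
  unfolding weakly_mixing_iff_strong_cesaro_null
proof
  fix F
  obtain M where "M > 0" and M: "\<And>k. k \<ge> 1 \<Longrightarrow> norm (x k) \<le> M"
    using bdd by (auto simp: bounded_pos)
  have norm_square: "norm (\<iota> (x k \<otimes> x k)) \<le> M\<^sup>2" if "k \<ge> 1" for k
    using cross \<iota> M[OF that] \<open>M > 0\<close>
    by (simp add: cross_norm_def is_completion_def power2_eq_square mult_mono)
  show "strong_cesaro_null (\<lambda>k. blinfun_apply F (\<iota> (x k \<otimes> x k)))"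
  proof (rule strong_cesaro_null_approx)
    fix e :: real assume "e > 0"
    have "F \<in> closure {F. \<exists>\<phi>. \<forall>u. blinfun_apply F (\<iota> u) = tensor_pairing \<phi> u}"
      using dual by (simp add: dual_tensor_completion_def)
    \<comment> \<open>The tolerance is chosen against the bound \<open>M\<^sup>2\<close> on the
      tensors, so that replacing \<open>F\<close> by \<open>G\<close> costs at most \<open>e\<close>
      at each \<open>k\<close>.\<close>
    moreover have "e / M\<^sup>2 > 0" using \<open>e > 0\<close> \<open>M > 0\<close> by simp
    ultimately obtain G \<phi> where G: "\<And>u. blinfun_apply G (\<iota> u) = tensor_pairing \<phi> u"
      and dist: "dist G F < e / M\<^sup>2"
      unfolding closure_approachable by blast
    have "\<bar>blinfun_apply F (\<iota> (x k \<otimes> x k))\<bar> \<le> \<bar>tensor_pairing \<phi> (x k \<otimes> x k)\<bar> + e"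
      if "k \<ge> 1" for k
    proof -
      have "\<bar>blinfun_apply (F - G) (\<iota> (x k \<otimes> x k))\<bar> \<le> norm (F - G) * norm (\<iota> (x k \<otimes> x k))"
        using norm_blinfun[of "F - G"] by simp
      also have "\<dots> \<le> e / M\<^sup>2 * M\<^sup>2"
        using dist norm_square[OF that] \<open>e > 0\<close>
        by (intro mult_mono) (simp_all add: dist_norm norm_minus_commute)
      also have "\<dots> = e" using \<open>M > 0\<close> by simp
      finally show ?thesis by (simp add: blinfun.diff_left G)
    qed
    then show "\<exists>b. strong_cesaro_null b \<and>
        (\<forall>k\<ge>1. \<bar>blinfun_apply F (\<iota> (x k \<otimes> x k))\<bar> \<le> \<bar>b k\<bar> + e)"
      using strong_cesaro_null_tensor_pairing[where y = x, OF mix M] by blast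
  qed
qed

theorem theorem2p8:
  fixes \<alpha> :: "('a::banach, 'a) tensor \<Rightarrow> real"
    and \<iota> :: "('a, 'a) tensor \<Rightarrow> 'z::banach"
    and x :: "nat \<Rightarrow> 'a"
  assumes "cross_norm \<alpha>"
    and "conj_norm_finite \<alpha>"
    and "cross_norm (conj_norm \<alpha>)"
    and "is_completion \<alpha> \<iota>"
    and "dual_tensor_completion \<iota> = UNIV"
    and "bounded (x ` {1..})"
  shows "(weakly_ergodic (\<lambda>k. \<iota> (x k \<otimes> x k)) \<longleftrightarrow>
            weakly_mixing_to_zero (\<lambda>k. \<iota> (x k \<otimes> x k))) \<and>
         (weakly_mixing_to_zero (\<lambda>k. \<iota> (x k \<otimes> x k)) \<longleftrightarrow> weakly_mixing_to_zero x)"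
proof -
  have "vs_norm \<alpha>"
    using assms(1) by (simp add: cross_norm_def)
  then have "weakly_mixing_to_zero x" if "weakly_ergodic (\<lambda>k. \<iota> (x k \<otimes> x k))"
    using weakly_mixing_of_weakly_ergodic_squares[OF _ assms(2,4) that] by blast
  \<comment> \<open>The implications form the cycle (i) to (iii) to (ii) to (i).\<close>
  then show ?thesis
    using weakly_mixing_imp_weakly_ergodic[of "\<lambda>k. \<iota> (x k \<otimes> x k)"]
      weakly_mixing_squares_of_weakly_mixing[OF assms(1,4,5,6)]
    by blast
qed

end
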